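(* Let $\mathcal{L}$ be a set of generators of $\mathcal{P}=\mathcal{Q}^{+}(2d-1,q)$, $d$ even, and let $\Omega_1,\Omega_2$ be the two classes of generators of $\mathcal{P}$. Then for any $x$, $\mathcal{L}$ is a Cameron-Liebler set of $\mathcal{P}$ with parameter $x$ if and only if $\mathcal{L}\cap\Omega_1$ and $\mathcal{L}\cap\Omega_2$ are Cameron-Liebler sets with parameter $x$ of $\Omega_1$ and $\Omega_2$, respectively.
   Context: $\mathcal{Q}^{+}(2d-1,q)$ is the hyperbolic quadric, a polar space of rank $d$ with parameter $e=0$; its generators are its $(d-1)$-dimensional projective subspaces and split into two classes, two generators lying in the same class iff their intersection has projective dimension $\equiv d-1\pmod 2$. A set $\mathcal{L}$ of generators of $\mathcal{P}$ is a Cameron-Liebler set with parameter $x=|\mathcal{L}|/\prod_{i=0}^{d-2}(q^{i}+1)$ if every generator $\pi$ is disjoint from exactly $(x-\chi_\pi)q^{\binom{d-1}{2}}$ elements of $\mathcal{L}$ ($\chi_\pi=1$ if $\pi\in\mathcal{L}$, else $0$). For a class $\mathcal{G}$, a set $\mathcal{L}'\subseteq\mathcal{G}$ is a Cameron-Liebler set of $\mathcal{G}$ with parameter $x=|\mathcal{L}'|/\prod_{i=1}^{d-2}(q^i+1)$ if every $\pi\in\mathcal{G}$ is disjoint from exactly $(x-\chi_\pi)q^{\binom{d-1}{2}}$ elements of $\mathcal{L}'$. *)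

theory Defs
  imports "HOL-Analysis.Cartesian_Space" "HOL-Number_Theory.Cong"
begin

text \<open>
  The projective space \<open>PG(2d-1,q)\<close> is modelled by the vector space \<open>'f ^ 'n\<close> over the finite
  field \<open>'f\<close> with \<open>q = CARD('f)\<close> and \<open>CARD('n) = 2 * d\<close>; its projective subspaces are the linear
  subspaces (sets of vectors), so that the empty projective subspace is \<open>{0}\<close>.
\<close>

definition proj_dim :: "('f::field ^ 'n::finite) set \<Rightarrow> int" where
  "proj_dim S = int (vec.dim S) - 1"

definition proj_disjoint :: "('f::field ^ 'n::finite) set \<Rightarrow> ('f ^ 'n) set \<Rightarrow> bool" where
  "proj_disjoint S T \<longleftrightarrow> S \<inter> T = {0}"

definition polar_form :: "('f::field ^ 'n::finite \<Rightarrow> 'f) \<Rightarrow> 'f ^ 'n \<Rightarrow> 'f ^ 'n \<Rightarrow> 'f" where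
  "polar_form Q u v = Q (u + v) - Q u - Q v"

definition quadratic_form :: "('f::field ^ 'n::finite \<Rightarrow> 'f) \<Rightarrow> bool" where
  "quadratic_form Q \<longleftrightarrow>
     (\<forall>c v. Q (c *s v) = c\<^sup>2 * Q v) \<and>
     (\<forall>v. Vector_Spaces.linear (*s) (*) (\<lambda>u. polar_form Q u v)) \<and>
     (\<forall>u. Vector_Spaces.linear (*s) (*) (\<lambda>v. polar_form Q u v))"

text \<open>This notion of nonsingularity is the correct one in every characteristic, including 2.\<close>

definition nonsingular :: "('f::field ^ 'n::finite \<Rightarrow> 'f) \<Rightarrow> bool" where
  "nonsingular Q \<longleftrightarrow> (\<forall>u. Q u = 0 \<and> (\<forall>v. polar_form Q u v = 0) \<longrightarrow> u = 0)"

definition totally_singular :: "('f::field ^ 'n::finite \<Rightarrow> 'f) \<Rightarrow> ('f ^ 'n) set \<Rightarrow> bool" where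
  "totally_singular Q S \<longleftrightarrow> vec.subspace S \<and> (\<forall>v\<in>S. Q v = 0)"

definition witt_index :: "('f::field ^ 'n::finite \<Rightarrow> 'f) \<Rightarrow> nat" where
  "witt_index Q = Max {vec.dim S |S. totally_singular Q S}"

text \<open>
  \<open>hyperbolic_quadric d Q\<close>: the form \<open>Q\<close> defines a hyperbolic quadric \<open>Q\<^sup>+(2d-1,q)\<close>. The
  subspaces of the corresponding polar space are the totally singular subspaces.
\<close>

definition hyperbolic_quadric :: "nat \<Rightarrow> ('f::field ^ 'n::finite \<Rightarrow> 'f) \<Rightarrow> bool" where
  "hyperbolic_quadric d Q \<longleftrightarrow>
     CARD('n) = 2 * d \<and> quadratic_form Q \<and> nonsingular Q \<and> witt_index Q = d"

definition generators :: "nat \<Rightarrow> ('f::field ^ 'n::finite \<Rightarrow> 'f) \<Rightarrow> ('f ^ 'n) set set" where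
  "generators d Q = {S. totally_singular Q S \<and> proj_dim S = int d - 1}"

definition same_class ::
  "nat \<Rightarrow> ('f::field ^ 'n::finite \<Rightarrow> 'f) \<Rightarrow> (('f ^ 'n) set \<times> ('f ^ 'n) set) set" where
  "same_class d Q = {(S, T). S \<in> generators d Q \<and> T \<in> generators d Q \<and>
     [proj_dim (S \<inter> T) = int d - 1] (mod 2)}"

definition generator_classes ::
  "nat \<Rightarrow> ('f::field ^ 'n::finite \<Rightarrow> 'f) \<Rightarrow> ('f ^ 'n) set set set" where
  "generator_classes d Q = generators d Q // same_class d Q"

text \<open>
  In both products below the index runs up to \<open>d - 2\<close>; the half-open intervals make them empty
  for \<open>d = 1\<close>. The lower bound is 0 for the whole polar space and 1 for a single class.
\<close>

definition cameron_liebler_set ::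
  "nat \<Rightarrow> ('f::{field,finite} ^ 'n::finite \<Rightarrow> 'f) \<Rightarrow> ('f ^ 'n) set set \<Rightarrow> real \<Rightarrow> bool" where
  "cameron_liebler_set d Q L x \<longleftrightarrow>
     L \<subseteq> generators d Q \<and>
     x = real (card L) / (\<Prod>i = 0..<d - 1. real CARD('f) ^ i + 1) \<and>
     (\<forall>S \<in> generators d Q.
        real (card {T \<in> L. proj_disjoint S T}) =
          (x - of_bool (S \<in> L)) * real CARD('f) ^ ((d - 1) choose 2))"

definition cameron_liebler_set_of_class ::
  "nat \<Rightarrow> ('f::{field,finite} ^ 'n::finite) set set \<Rightarrow> ('f ^ 'n) set set \<Rightarrow> real \<Rightarrow> bool" where
  "cameron_liebler_set_of_class d G L x \<longleftrightarrow>
     L \<subseteq> G \<and>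
     x = real (card L) / (\<Prod>i = 1..<d - 1. real CARD('f) ^ i + 1) \<and>
     (\<forall>S \<in> G.
        real (card {T \<in> L. proj_disjoint S T}) =
          (x - of_bool (S \<in> L)) * real CARD('f) ^ ((d - 1) choose 2))"

end

theory Submission
  imports Defs
begin

text \<open>
  For even \<open>d\<close>, disjoint generators lie in the same class, so the disjointness conditions for \<open>\<L>\<close> are
  exactly those for \<open>\<L> \<inter> \<Omega>\<^sub>1\<close> and \<open>\<L> \<inter> \<Omega>\<^sub>2\<close> together. What remains is that both intersections
  have the same size if \<open>\<L>\<close> is a Cameron-Liebler set. Double counting disjoint pairs in
  \<open>\<Omega>\<^sub>i \<times> (\<L> \<inter> \<Omega>\<^sub>i)\<close> yields \<open>|\<L> \<inter> \<Omega>\<^sub>i| (N + q\<^bsup>C(d-1,2)\<^esup>) = x |\<Omega>\<^sub>i| q\<^bsup>C(d-1,2)\<^esup>\<close>, where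
  \<open>N\<close> is the number of generators disjoint from a given one. That \<open>N\<close> is well defined and that
  \<open>|\<Omega>\<^sub>1| = |\<Omega>\<^sub>2|\<close> follows without computing these numbers: reflections in nonsingular vectors
  move every generator to an adjacent one, exchange the two classes, and realise every adjacency
  of the connected graph of generators.
\<close>

section \<open>Subspaces of codimension one\<close>

text \<open>If some \<open>s\<close> in \<open>S\<close> has \<open>f s \<noteq> 0\<close>,
  subtracting a multiple of \<open>s\<close> moves any vector of \<open>S\<close> into the kernel,
  so the kernel and \<open>s\<close> span \<open>S\<close>.\<close>

lemma dim_le_Suc_dim_kernel:
  fixes f :: "'f::field ^ 'n::finite \<Rightarrow> 'f"
  assumes S: "vec.subspace S"
    and add: "\<And>x y. f (x + y) = f x + f y" and scale: "\<And>c x. f (c *s x) = c * f x"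
  shows "vec.dim S \<le> Suc (vec.dim {x \<in> S. f x = 0})"
proof (cases "\<exists>s\<in>S. f s \<noteq> 0")
  case True
  then obtain s where s: "s \<in> S" "f s \<noteq> 0" by blast
  have minus: "f (x - y) = f x - f y" for x y
    using add[of "x - y" y] by simp
  have "S \<subseteq> vec.span (insert s {x \<in> S. f x = 0})"
  proof
    fix x assume x: "x \<in> S"
    have "x - (f x / f s) *s s \<in> {x \<in> S. f x = 0}"
      using x s S by (simp add: minus scale vec.subspace_diff vec.subspace_scale)
    then show "x \<in> vec.span (insert s {x \<in> S. f x = 0})"
      unfolding vec.span_breakdown_eq by (blast intro: vec.span_base)
  qed
  then have "vec.dim S \<le> vec.dim (insert s {x \<in> S. f x = 0})"
    by (rule vec.dim_mono)
  also have "\<dots> \<le> Suc (vec.dim {x \<in> S. f x = 0})"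
    by (simp add: vec.dim_insert)
  finally show ?thesis .
next
  case False
  then have "{x \<in> S. f x = 0} = S" by auto
  then show ?thesis by simp
qed

text \<open>Supplies a complement of known size: the vectors added when a basis of \<open>S\<close>
  is extended to one of \<open>T\<close>.\<close>

lemma obtain_relative_basis:
  fixes S T :: "('f::field ^ 'n::finite) set"
  assumes "S \<subseteq> T"
  obtains A where "finite A" "A \<subseteq> T" "T \<subseteq> vec.span (S \<union> A)" "card A + vec.dim S = vec.dim T"
proof -
  obtain B where B: "B \<subseteq> S" "vec.independent B" "S \<subseteq> vec.span B" "card B = vec.dim S"
    using vec.basis_exists by blast
  obtain C where C: "B \<subseteq> C" "C \<subseteq> T" "vec.independent C" "T \<subseteq> vec.span C"
    using vec.maximal_independent_subset_extend[of B T] B assms by blast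
  have fin: "finite C" using C(3) vec.finiteI_independent by blast
  show thesis
  proof
    show "finite (C - B)" "C - B \<subseteq> T" using fin C by auto
    have "C \<subseteq> S \<union> (C - B)" using B by blast
    then show "T \<subseteq> vec.span (S \<union> (C - B))" using C(4) vec.span_mono by blast
    have "card C = vec.dim T" using C vec.basis_card_eq_dim by blast
    then show "card (C - B) + vec.dim S = vec.dim T"
      using B(4) C(1) fin by (metis card_Diff_subset card_mono finite_subset le_add_diff_inverse2)
  qed
qed

section \<open>Generators of a hyperbolic quadric\<close>

locale hyperbolic_space =
  fixes d :: nat and Q :: "'f::field ^ 'n::finite \<Rightarrow> 'f"
  assumes hyperbolic: "hyperbolic_quadric d Q"
begin

abbreviation B :: "'f ^ 'n \<Rightarrow> 'f ^ 'n \<Rightarrow> 'f" where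
  "B \<equiv> polar_form Q"

text \<open>Taken for arbitrary sets, since it is also applied to finite sets of vectors, each
  imposing one linear condition.\<close>

definition perp :: "('f ^ 'n) set \<Rightarrow> ('f ^ 'n) set" where
  "perp S = {x. \<forall>w\<in>S. B x w = 0}"

text \<open>Adjacency in the dual polar graph; \<open>Suc\<close> avoids truncated
  subtraction.\<close>

definition adjacent :: "('f ^ 'n) set \<Rightarrow> ('f ^ 'n) set \<Rightarrow> bool" where
  "adjacent S T \<longleftrightarrow> S \<in> generators d Q \<and> T \<in> generators d Q \<and> Suc (vec.dim (S \<inter> T)) = d"

text \<open>Dividing by \<open>Q v\<close>, which is half of \<open>B v v\<close> when 2 is
  invertible, gives the orthogonal reflection in every characteristic. For \<open>Q v = 0\<close>
  division by zero makes it the identity.\<close>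

definition reflection :: "'f ^ 'n \<Rightarrow> 'f ^ 'n \<Rightarrow> 'f ^ 'n" where
  "reflection v x = x - (B x v / Q v) *s v"

section \<open>Polar form and orthogonal complements\<close>

lemma Q_scale: "Q (c *s v) = c\<^sup>2 * Q v"
  using hyperbolic by (auto simp: hyperbolic_quadric_def quadratic_form_def)

lemma Q_add: "Q (u + v) = Q u + Q v + B u v"
  by (simp add: polar_form_def)

lemma B_commute: "B u v = B v u"
  by (simp add: polar_form_def add.commute)

lemma B_add_left: "B (u + u') v = B u v + B u' v"
  and B_scale_left: "B (c *s u) v = c * B u v"
  using hyperbolic
  by (auto simp: hyperbolic_quadric_def quadratic_form_def Vector_Spaces.linear_iff)

lemma B_add_right: "B v (u + u') = B v u + B v u'"
  and B_scale_right: "B v (c *s u) = c * B v u"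
  using B_add_left B_scale_left B_commute by metis+

lemma B_diff_left: "B (u - u') v = B u v - B u' v"
  using B_add_left[of "u - u'" u' v] by simp

lemma B_diff_right: "B v (u - u') = B v u - B v u'"
  using B_diff_left B_commute by metis

lemma B_zero_left [simp]: "B 0 v = 0"
  using B_scale_left[of 0 0 v] by simp

lemma B_self: "B v v = 2 * Q v"
proof -
  have "v + v = 2 *s v"
    by (metis one_add_one vec.scale_left_distrib vec.scale_one)
  then show ?thesis
    using Q_scale[of 2 v] by (simp add: polar_form_def)
qed

lemmas B_simps = B_add_left B_add_right B_scale_left B_scale_right B_diff_left B_diff_right

lemma d_pos: "d > 0"
  using hyperbolic zero_less_card_finite[where 'a='n] unfolding hyperbolic_quadric_def by linarith

lemma subspace_perp: "vec.subspace (perp S)"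
  by (auto simp: vec.subspace_def perp_def B_simps)

lemma perp_spanI: "(\<And>w. w \<in> S \<Longrightarrow> B x w = 0) \<Longrightarrow> y \<in> vec.span S \<Longrightarrow> B x y = 0"
proof -
  assume "\<And>w. w \<in> S \<Longrightarrow> B x w = 0"
  then have "S \<subseteq> perp {x}" by (auto simp: perp_def B_commute)
  then have "vec.span S \<subseteq> perp {x}" by (intro vec.span_minimal subspace_perp)
  then show "y \<in> vec.span S \<Longrightarrow> B x y = 0" by (auto simp: perp_def B_commute)
qed

text \<open>By induction on \<open>A\<close>: each further vector cuts the subspace by one linear
  functional, which costs at most one dimension.\<close>

lemma dim_le_dim_Int_perp:
  assumes "finite A" "vec.subspace S"
  shows "vec.dim S \<le> vec.dim (S \<inter> perp A) + card A"
  using assms(1)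
proof induction
  case empty
  then show ?case by (simp add: perp_def)
next
  case (insert a A)
  have "vec.dim (S \<inter> perp A) \<le> Suc (vec.dim {x \<in> S \<inter> perp A. B x a = 0})"
    by (rule dim_le_Suc_dim_kernel)
      (simp_all add: B_simps vec.subspace_inter assms(2) subspace_perp)
  moreover have "{x \<in> S \<inter> perp A. B x a = 0} = S \<inter> perp (insert a A)"
    by (auto simp: perp_def)
  ultimately show ?case using insert by simp
qed

section \<open>Generators as maximal totally singular subspaces\<close>

lemma generator_iff:
  "S \<in> generators d Q \<longleftrightarrow> vec.subspace S \<and> (\<forall>v\<in>S. Q v = 0) \<and> vec.dim S = d"
  by (auto simp: generators_def totally_singular_def proj_dim_def)

lemma generator_subspace: "S \<in> generators d Q \<Longrightarrow> vec.subspace S"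
  and generator_dim: "S \<in> generators d Q \<Longrightarrow> vec.dim S = d"
  and generator_Q: "S \<in> generators d Q \<Longrightarrow> v \<in> S \<Longrightarrow> Q v = 0"
  by (auto simp: generator_iff)

lemma generator_eqI:
  "S \<in> generators d Q \<Longrightarrow> T \<in> generators d Q \<Longrightarrow> S \<subseteq> T \<Longrightarrow> S = T"
  using vec.subspace_dim_equal[of S T] by (simp add: generator_iff)

lemma generator_B: "S \<in> generators d Q \<Longrightarrow> u \<in> S \<Longrightarrow> v \<in> S \<Longrightarrow> B u v = 0"
  by (simp add: polar_form_def generator_iff vec.subspace_add)

text \<open>
  Nonsingularity only excludes singular vectors from the radical of the polar form, which suffices
  here because the vectors of \<open>S\<close> are singular. Were \<open>perp S\<close> larger than \<open>S\<close>, it would have a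
  complement of dimension less than \<open>d = dim S\<close>, and some nonzero vector of \<open>S\<close> would be orthogonal
  to this complement as well as to \<open>perp S\<close>.
\<close>
lemma perp_generator:
  assumes S: "S \<in> generators d Q"
  shows "perp S = S"
proof -
  have sub: "S \<subseteq> perp S" using generator_B[OF S] by (auto simp: perp_def)
  have "vec.dim (perp S) \<le> d"
  proof (rule ccontr)
    assume big: "\<not> vec.dim (perp S) \<le> d"
    obtain A where A: "finite A" "UNIV \<subseteq> vec.span (perp S \<union> A)"
      "card A + vec.dim (perp S) = vec.dim (UNIV :: ('f ^ 'n) set)"
      using obtain_relative_basis[OF subset_UNIV[of "perp S"]] .
    have "card A + vec.dim (perp S) = 2 * d"
      using A(3) hyperbolic by (simp only: vec_dim_card hyperbolic_quadric_def)
    then have "card A < d" using big by simp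
    then have "vec.dim (S \<inter> perp A) \<noteq> 0"
      using dim_le_dim_Int_perp[OF A(1), of S] S by (simp add: generator_iff del: vec.dim_eq_0)
    then obtain p where p: "p \<in> S" "p \<in> perp A" "p \<noteq> 0" by auto
    have "B p w = 0" if "w \<in> perp S \<union> A" for w
      using that p by (auto simp: perp_def B_commute)
    then have "B p v = 0" for v
      using A(2) perp_spanI[of "perp S \<union> A" p v] by blast
    moreover have "Q p = 0" using generator_Q[OF S p(1)] .
    ultimately show False
      using hyperbolic p(3) by (auto simp: hyperbolic_quadric_def nonsingular_def)
  qed
  then show ?thesis
    using vec.subspace_dim_equal[OF generator_subspace[OF S] subspace_perp sub]
    by (simp add: generator_dim[OF S])
qed

text \<open>The nontrivial inclusion of \<open>perp S = S\<close>: orthogonality alone places a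
  vector in a generator.\<close>

lemma mem_generatorI:
  "S \<in> generators d Q \<Longrightarrow> (\<And>w. w \<in> S \<Longrightarrow> B x w = 0) \<Longrightarrow> x \<in> S"
  using perp_generator[of S] by (auto simp: perp_def)

lemma generator_eq_span_insert:
  assumes S: "S \<in> generators d Q" and W: "W \<subseteq> S" "Suc (vec.dim W) = d"
    and a: "a \<in> S" "a \<notin> vec.span W"
  shows "S = vec.span (insert a W)"
proof -
  have "vec.span (insert a W) \<subseteq> S"
    using W a S by (intro vec.span_minimal) (auto simp: generator_iff)
  moreover have "vec.dim (vec.span (insert a W)) = d"
    using W(2) a(2) by (simp add: vec.dim_insert)
  ultimately show ?thesis
    using vec.subspace_dim_equal[of "vec.span (insert a W)" S] S
    by (metis generator_dim generator_subspace order_refl vec.subspace_span)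
qed

section \<open>Adjacent generators: intersections, parity and connectedness\<close>

lemma adjacent_commute: "adjacent S T \<longleftrightarrow> adjacent T S"
  by (auto simp: adjacent_def Int_commute)

lemma subspace_Int_generators:
  "S \<in> generators d Q \<Longrightarrow> T \<in> generators d Q \<Longrightarrow> vec.subspace (S \<inter> T)"
  by (simp add: generator_subspace vec.subspace_inter)

lemma span_Int_generators:
  "S \<in> generators d Q \<Longrightarrow> T \<in> generators d Q \<Longrightarrow> vec.span (S \<inter> T) = S \<inter> T"
  using subspace_Int_generators vec.span_eq_iff by blast

lemma adjacent_span:
  assumes "adjacent S T" "a \<in> S - T"
  shows "S = vec.span (insert a (S \<inter> T))"
  using assms generator_eq_span_insert[of S "S \<inter> T" a] span_Int_generators[of S T]
  by (auto simp: adjacent_def)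

text \<open>If \<open>a\<close> and \<open>b\<close> were orthogonal, \<open>b\<close> would be
  orthogonal to \<open>S\<close>, which is spanned by \<open>a\<close> and
  \<open>S \<inter> T\<close>, and hence lie in \<open>S\<close>.\<close>

lemma adjacent_not_orthogonal:
  assumes adj: "adjacent S T" and a: "a \<in> S - T" and b: "b \<in> T - S"
  shows "B a b \<noteq> 0"
proof
  assume ab: "B a b = 0"
  have S: "S \<in> generators d Q" using adj by (simp add: adjacent_def)
  have T: "T \<in> generators d Q" using adj by (simp add: adjacent_def)
  have "B b w = 0" if "w \<in> insert a (S \<inter> T)" for w
    using that ab b generator_B[OF T] by (auto simp: B_commute)
  then have "B b w = 0" if "w \<in> S" for w
    using that adjacent_span[OF adj a] perp_spanI[of "insert a (S \<inter> T)" b w] by blast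
  then have "b \<in> S" using mem_generatorI[OF S] by blast
  with b show False by blast
qed

lemma adjacent_obtain:
  assumes "adjacent S T"
  obtains a b where "a \<in> S - T" "b \<in> T - S"
proof -
  have "S \<inter> T \<noteq> S" "S \<inter> T \<noteq> T" using assms by (auto simp: adjacent_def generator_iff)
  then show thesis using that by blast
qed

text \<open>
  The quotient \<open>(S \<inter> T)\<^sup>\<bottom> / (S \<inter> T)\<close> is a hyperbolic line, whose only singular points are those of
  \<open>S\<close> and \<open>T\<close>. Hence \<open>P \<inter> (S \<inter> T)\<^sup>\<bottom>\<close>, which is larger than \<open>P \<inter> S \<inter> T\<close>, meets \<open>S\<close> or \<open>T\<close> outside
  \<open>S \<inter> T\<close>, but never both.
\<close>
lemma adjacent_Int_meets:
  assumes adj: "adjacent S T" and P: "P \<in> generators d Q"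
  shows "P \<inter> S \<subseteq> T \<longleftrightarrow> \<not> P \<inter> T \<subseteq> S"
proof
  assume PS: "P \<inter> S \<subseteq> T"
  show "\<not> P \<inter> T \<subseteq> S"
  proof
    assume PT: "P \<inter> T \<subseteq> S"
    have S: "S \<in> generators d Q" and T: "T \<in> generators d Q"
      and dim: "Suc (vec.dim (S \<inter> T)) = d"
      using adj by (simp_all add: adjacent_def)
    let ?W = "S \<inter> T"
    obtain a b where a: "a \<in> S - T" and b: "b \<in> T - S" using adjacent_obtain[OF adj] .
    have nz: "B a b \<noteq> 0" using adjacent_not_orthogonal[OF adj a b] .
    obtain A where A: "finite A" "A \<subseteq> ?W" "?W \<subseteq> vec.span (P \<inter> ?W \<union> A)"
      "card A + vec.dim (P \<inter> ?W) = vec.dim ?W"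
      using obtain_relative_basis[OF Int_lower2[of P ?W]] .
    have "d \<le> vec.dim (P \<inter> perp A) + card A"
      using dim_le_dim_Int_perp[OF A(1) generator_subspace[OF P]] generator_dim[OF P] by simp
    then have "vec.dim (P \<inter> ?W) < vec.dim (P \<inter> perp A)"
      using A(4) dim by simp
    then have "\<not> P \<inter> perp A \<subseteq> P \<inter> ?W" using vec.dim_subset leD by blast
    then obtain c where c: "c \<in> P" "c \<in> perp A" "c \<notin> ?W" by blast
    \<comment> \<open>Orthogonality to \<open>P \<inter> ?W\<close> is automatic inside
      \<open>P\<close>, so only the conditions from \<open>A\<close> had to be imposed; this is what
      left room for \<open>c\<close>.\<close>
    have "B c w = 0" if "w \<in> P \<inter> ?W \<union> A" for w
      using that c generator_B[OF P] by (auto simp: perp_def)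
    then have cW: "B c w = 0" if "w \<in> ?W" for w
      using that A(3) perp_spanI[of "P \<inter> ?W \<union> A" c w] by blast
    \<comment> \<open>\<open>e\<close> is \<open>c\<close> minus its projection to the hyperbolic
      plane of \<open>a\<close> and \<open>b\<close>. Being orthogonal to both generators it lies in
      both, so \<open>Q c\<close> reduces to the product of the two coefficients with
      \<open>B a b\<close>, and one coefficient vanishes.\<close>
    define e where "e = c - (B c b / B a b) *s a - (B c a / B a b) *s b"
    have aa: "B a a = 0" and bb: "B b b = 0"
      using a b generator_B[OF S] generator_B[OF T] by auto
    have ea: "B e a = 0" and eb: "B e b = 0"
      using nz aa bb by (simp_all add: e_def B_simps B_commute[of b a])
    have eW: "B e w = 0" if "w \<in> ?W" for w
      using that a b cW[OF that] generator_B[OF S, of a w] generator_B[OF T, of b w]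
      by (simp add: e_def B_simps)
    have "B e w = 0" if "w \<in> S" for w
      using that eW ea adjacent_span[OF adj a] perp_spanI[of "insert a ?W" e w] by blast
    then have eS: "e \<in> S" using mem_generatorI[OF S] by blast
    have "insert b (T \<inter> S) = insert b ?W" by blast
    then have "B e w = 0" if "w \<in> T" for w
      using that eW eb adjacent_span[OF adjacent_commute[THEN iffD1, OF adj] b]
        perp_spanI[of "insert b ?W" e w] by auto
    then have eT: "e \<in> T" using mem_generatorI[OF T] by blast
    have c_eq: "c = (e + (B c b / B a b) *s a) + (B c a / B a b) *s b"
      by (simp add: e_def)
    have "Q c = (B c b / B a b) * (B c a / B a b) * B a b"
    proof -
      have "Q (e + (B c b / B a b) *s a) = 0"
        using eS a S by (intro generator_Q[OF S]) (auto intro!: vec.subspace_add vec.subspace_scale simp: generator_iff)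
      moreover have "Q ((B c a / B a b) *s b) = 0"
        using b generator_Q[OF T] by (simp add: Q_scale)
      ultimately show ?thesis
        by (subst c_eq, subst Q_add) (simp add: B_simps eb)
    qed
    then have "B c b = 0 \<or> B c a = 0"
      using generator_Q[OF P c(1)] nz by simp
    then show False
    proof
      assume "B c b = 0"
      then have "c = e + (B c a / B a b) *s b" using c_eq by simp
      then have "c \<in> T"
        using eT b generator_subspace[OF T] by (metis DiffD1 vec.subspace_add vec.subspace_scale)
      then show False using c PT by blast
    next
      assume "B c a = 0"
      then have "c = e + (B c b / B a b) *s a" using c_eq by simp
      then have "c \<in> S"
        using eS a generator_subspace[OF S] by (metis DiffD1 vec.subspace_add vec.subspace_scale)
      then show False using c PS by blast
    qed
  qed
next
  assume "\<not> P \<inter> T \<subseteq> S"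
  then obtain b where b: "b \<in> P" "b \<in> T - S" by blast
  show "P \<inter> S \<subseteq> T"
  proof
    fix a assume "a \<in> P \<inter> S"
    then show "a \<in> T"
      using b adjacent_not_orthogonal[OF adj, of a b] generator_B[OF P, of a b] by blast
  qed
qed

text \<open>Pick \<open>b\<close> in \<open>P \<inter> T\<close> outside \<open>S\<close>. As
  \<open>b\<close> and \<open>S \<inter> T\<close> span \<open>T\<close>, subtracting a multiple of
  \<open>b\<close> takes any vector of \<open>P \<inter> T\<close> into
  \<open>P \<inter> S\<close>.\<close>

lemma dim_Int_adjacent_Suc:
  assumes adj: "adjacent S T" and P: "P \<in> generators d Q" and PS: "P \<inter> S \<subseteq> T"
  shows "vec.dim (P \<inter> T) = Suc (vec.dim (P \<inter> S))"
proof -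
  have S: "S \<in> generators d Q" and T: "T \<in> generators d Q"
    using adj by (simp_all add: adjacent_def)
  have "\<not> P \<inter> T \<subseteq> S" using adjacent_Int_meets[OF adj P] PS by blast
  then obtain b where b: "b \<in> P" "b \<in> T - S" by blast
  have "P \<inter> T = vec.span (insert b (P \<inter> S))"
  proof
    show "vec.span (insert b (P \<inter> S)) \<subseteq> P \<inter> T"
      using b PS P T by (intro vec.span_minimal subspace_Int_generators) auto
    show "P \<inter> T \<subseteq> vec.span (insert b (P \<inter> S))"
    proof
      fix y assume y: "y \<in> P \<inter> T"
      have "T = vec.span (insert b (T \<inter> S))"
        using adjacent_span[OF adjacent_commute[THEN iffD1, OF adj] b(2)] .
      then obtain k where "y - k *s b \<in> vec.span (T \<inter> S)"
        using y vec.span_breakdown_eq[of y b "T \<inter> S"] by blast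
      then have "y - k *s b \<in> S"
        using span_Int_generators[OF T S] by blast
      moreover have "y - k *s b \<in> P"
        using y b generator_subspace[OF P] by (simp add: vec.subspace_diff vec.subspace_scale)
      ultimately have "y - k *s b \<in> vec.span (P \<inter> S)" by (simp add: vec.span_base)
      then show "y \<in> vec.span (insert b (P \<inter> S))" by (auto simp: vec.span_breakdown_eq)
    qed
  qed
  moreover have "b \<notin> vec.span (P \<inter> S)"
    using b span_Int_generators[OF P S] by blast
  ultimately show ?thesis by (simp add: vec.dim_insert)
qed

text \<open>One of the two intersections contains the other with codimension one.\<close>

lemma even_dim_Int_adjacent:
  assumes adj: "adjacent S T" and P: "P \<in> generators d Q"
  shows "even (vec.dim (P \<inter> S)) \<longleftrightarrow> odd (vec.dim (P \<inter> T))"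
proof (cases "P \<inter> S \<subseteq> T")
  case True
  then show ?thesis using dim_Int_adjacent_Suc[OF adj P] by simp
next
  case False
  then have "P \<inter> T \<subseteq> S" using adjacent_Int_meets[OF adj P] by blast
  then show ?thesis
    using dim_Int_adjacent_Suc[OF adjacent_commute[THEN iffD1, OF adj] P] by simp
qed

text \<open>For \<open>c\<close> in \<open>T\<close> outside \<open>S\<close>, the generator spanned
  by \<open>c\<close> and the hyperplane of \<open>S\<close> orthogonal to \<open>c\<close> still
  contains \<open>S \<inter> T\<close>, and gains \<open>c\<close>.\<close>

lemma exists_closer_adjacent:
  assumes S: "S \<in> generators d Q" and T: "T \<in> generators d Q" and "S \<noteq> T"
  obtains R where "adjacent S R" "vec.dim (S \<inter> T) < vec.dim (R \<inter> T)"
proof -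
  have "\<not> T \<subseteq> S" using generator_eqI[OF T S] assms(3) by blast
  then obtain c where c: "c \<in> T" "c \<notin> S" by blast
  define W where "W = S \<inter> perp {c}"
  have W: "vec.subspace W"
    by (simp add: W_def S generator_subspace subspace_perp vec.subspace_inter)
  have spanW: "vec.span W = W" using W by simp
  have cW: "c \<notin> W" using c by (simp add: W_def)
  have "W \<noteq> S"
  proof
    assume "W = S"
    then have "B c w = 0" if "w \<in> S" for w
      using that B_commute by (auto simp: W_def perp_def)
    then show False using mem_generatorI[OF S] c by blast
  qed
  then have "vec.dim W < d"
    using vec.subspace_dim_equal[OF W generator_subspace[OF S]] generator_dim[OF S]
    by (auto simp: W_def)
  moreover have "d \<le> vec.dim W + 1"
    using dim_le_dim_Int_perp[of "{c}" S] S by (simp add: W_def generator_iff)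
  ultimately have dimW: "Suc (vec.dim W) = d" by simp
  define R where "R = vec.span (insert c W)"
  have "Q y = 0" if y: "y \<in> R" for y
  proof -
    obtain k where k: "y - k *s c \<in> W"
      using y unfolding R_def vec.span_breakdown_eq spanW by blast
    have "Q ((y - k *s c) + k *s c) = 0"
      unfolding Q_add using k c generator_Q[OF S] generator_Q[OF T]
      by (simp add: W_def perp_def Q_scale B_scale_right)
    then show ?thesis by simp
  qed
  moreover have "vec.dim R = d"
    unfolding R_def vec.dim_span vec.dim_insert spanW using dimW cW by simp
  ultimately have R: "R \<in> generators d Q" by (simp add: generator_iff R_def)
  have subR: "insert c W \<subseteq> R" by (simp add: R_def vec.span_superset)
  have "S \<inter> R \<noteq> R" using c subR by blast
  then have "vec.dim (S \<inter> R) < d"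
    using vec.subspace_dim_equal[OF subspace_Int_generators[OF S R] generator_subspace[OF R]]
      generator_dim[OF R] by auto
  moreover have "vec.dim W \<le> vec.dim (S \<inter> R)"
    using subR by (intro vec.dim_subset) (auto simp: W_def)
  ultimately have "adjacent S R" using dimW S R by (simp add: adjacent_def)
  moreover have "vec.dim (S \<inter> T) < vec.dim (R \<inter> T)"
  proof -
    have "S \<inter> T \<subseteq> W" using c generator_B[OF T] by (auto simp: W_def perp_def)
    then have "insert c (S \<inter> T) \<subseteq> R \<inter> T" using c subR by blast
    then have "vec.dim (insert c (S \<inter> T)) \<le> vec.dim (R \<inter> T)" by (rule vec.dim_subset)
    moreover have "c \<notin> vec.span (S \<inter> T)"
      using c span_Int_generators[OF S T] by blast
    ultimately show ?thesis by (simp add: vec.dim_insert)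
  qed
  ultimately show thesis using that by blast
qed

lemma adjacent_connected:
  assumes "S \<in> generators d Q" "T \<in> generators d Q"
  shows "adjacent\<^sup>*\<^sup>* S T"
  using assms
proof (induction "d - vec.dim (S \<inter> T)" arbitrary: S rule: less_induct)
  case less
  show ?case
  proof (cases "S = T")
    case False
    obtain R where R: "adjacent S R" "vec.dim (S \<inter> T) < vec.dim (R \<inter> T)"
      using exists_closer_adjacent[OF less.prems False] .
    \<comment> \<open>This bound makes the truncated difference in the induction measure decrease
      strictly.\<close>
    have "vec.dim (R \<inter> T) \<le> d"
      using vec.dim_subset[of "R \<inter> T" T] generator_dim[OF less.prems(2)] by simp
    then have "adjacent\<^sup>*\<^sup>* R T"
      using R less.hyps[of R] less.prems by (simp add: adjacent_def)
    then show ?thesis using R(1) by (rule converse_rtranclp_into_rtranclp[rotated])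
  qed simp
qed

text \<open>Each step of a path from \<open>S\<close> to \<open>T\<close> flips the parity of the
  intersections with \<open>R\<close> and with \<open>S\<close> alike, so the parity of the sum of
  their dimensions is constant along it. This makes \<open>same_class\<close> an equivalence on
  generators with at most two classes.\<close>

lemma even_dim_Int_triangle:
  assumes R: "R \<in> generators d Q" and S: "S \<in> generators d Q" and T: "T \<in> generators d Q"
  shows "even (d + vec.dim (R \<inter> T)) \<longleftrightarrow>
    (even (d + vec.dim (R \<inter> S)) \<longleftrightarrow> even (d + vec.dim (S \<inter> T)))"
proof -
  have "even (vec.dim (R \<inter> S) + vec.dim (S \<inter> S)) \<longleftrightarrow>
      even (vec.dim (R \<inter> T) + vec.dim (S \<inter> T))"
    using adjacent_connected[OF S T]
  proof (induction rule: rtranclp_induct)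
    case (step U V)
    then show ?case
      using even_dim_Int_adjacent[OF step.hyps(2) R] even_dim_Int_adjacent[OF step.hyps(2) S] by simp
  qed simp
  then show ?thesis using generator_dim[OF S] by auto
qed

section \<open>Reflections\<close>

text \<open>The square term and the polar term contributed by the multiple of \<open>v\<close>
  cancel.\<close>

lemma Q_reflection:
  assumes "Q v \<noteq> 0"
  shows "Q (reflection v x) = Q x"
proof -
  have "reflection v x = x + (- (B x v / Q v)) *s v"
    by (simp add: reflection_def)
  then show ?thesis
    using assms by (simp only: Q_add Q_scale B_scale_right) (simp add: power2_eq_square)
qed

lemma reflection_reflection:
  assumes "Q v \<noteq> 0"
  shows "reflection v (reflection v x) = x"
proof -
  have "B (reflection v x) v = - B x v"
    using assms by (simp add: reflection_def B_simps B_self)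
  then have "reflection v (reflection v x) = reflection v x + (B x v / Q v) *s v"
    by (simp add: reflection_def[of v "reflection v x"])
  then show ?thesis by (simp add: reflection_def)
qed

lemma reflection_image_image: "Q v \<noteq> 0 \<Longrightarrow> reflection v ` reflection v ` S = S"
  by (simp add: image_image reflection_reflection)

lemma linear_reflection: "Vector_Spaces.linear (*s) (*s) (reflection v)"
  unfolding Vector_Spaces.linear_iff
proof (intro conjI allI vec.vector_space_axioms)
  show "reflection v (x + y) = reflection v x + reflection v y" for x y
    by (simp add: reflection_def B_add_left add_divide_distrib vec.scale_left_distrib)
  show "reflection v (c *s x) = c *s reflection v x" for c x
    by (simp add: reflection_def B_scale_left vec.scale_right_diff_distrib)
qed

lemma inj_reflection: "Q v \<noteq> 0 \<Longrightarrow> inj (reflection v)"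
  by (metis injI reflection_reflection)

lemma reflection_generator:
  assumes v: "Q v \<noteq> 0" and S: "S \<in> generators d Q"
  shows "reflection v ` S \<in> generators d Q"
proof -
  have "vec.dim (reflection v ` S) = d"
    using vec.dim_image_eq[OF linear_reflection, of v S] inj_reflection[OF v] generator_dim[OF S]
    by (simp add: inj_on_subset)
  moreover have "vec.subspace (reflection v ` S)"
    using vec.linear_subspace_image[OF linear_reflection generator_subspace[OF S]] .
  ultimately show ?thesis
    using S v by (auto simp: generator_iff Q_reflection)
qed

text \<open>Vectors of \<open>S\<close> orthogonal to \<open>v\<close> are fixed, so at most one
  dimension is lost. One is lost: some \<open>x\<close> in \<open>S\<close> is not orthogonal to
  \<open>v\<close>, and if its image were in \<open>S\<close>, so would be a nonzero multiple of the
  nonsingular \<open>v\<close>.\<close>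

lemma adjacent_reflection:
  assumes v: "Q v \<noteq> 0" and S: "S \<in> generators d Q"
  shows "adjacent S (reflection v ` S)"
proof -
  let ?T = "reflection v ` S"
  have T: "?T \<in> generators d Q" using reflection_generator[OF v S] .
  have "S \<inter> perp {v} \<subseteq> S \<inter> ?T"
  proof
    fix x assume x: "x \<in> S \<inter> perp {v}"
    then have "reflection v x = x" by (simp add: reflection_def perp_def)
    then show "x \<in> S \<inter> ?T" using x by (metis Int_iff image_eqI)
  qed
  then have "d \<le> vec.dim (S \<inter> ?T) + 1"
    using dim_le_dim_Int_perp[of "{v}" S] vec.dim_subset[of "S \<inter> perp {v}" "S \<inter> ?T"] S
    by (simp add: generator_iff)
  moreover have "vec.dim (S \<inter> ?T) < d"
  proof (rule ccontr)
    assume "\<not> vec.dim (S \<inter> ?T) < d"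
    then have "S \<inter> ?T = S"
      using vec.subspace_dim_equal[OF subspace_Int_generators[OF S T] generator_subspace[OF S]]
        generator_dim[OF S] by auto
    then have ST: "S = ?T" using generator_eqI[OF S T] by blast
    have "v \<notin> S" using generator_Q[OF S] v by blast
    then obtain x where x: "x \<in> S" "B x v \<noteq> 0"
      using mem_generatorI[OF S, of v] B_commute by metis
    have "reflection v x \<in> S" using ST x by blast
    then have "x - reflection v x \<in> S" using x S by (simp add: generator_iff vec.subspace_diff)
    then have "(B x v / Q v) *s v \<in> S" by (simp add: reflection_def)
    then have "Q ((B x v / Q v) *s v) = 0" using generator_Q[OF S] by blast
    then show False using x v by (simp add: Q_scale)
  qed
  ultimately show ?thesis using S T by (simp add: adjacent_def)
qed

text \<open>The reflection in \<open>a - b\<close>, with \<open>a\<close> in \<open>S - T\<close>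
  and \<open>b\<close> in \<open>T - S\<close>, sends \<open>a\<close> to \<open>b\<close> and fixes
  \<open>S \<inter> T\<close> pointwise.\<close>

lemma adjacent_obtain_reflection:
  assumes adj: "adjacent S T"
  obtains v where "Q v \<noteq> 0" "reflection v ` S = T"
proof -
  have S: "S \<in> generators d Q" and T: "T \<in> generators d Q"
    using adj by (simp_all add: adjacent_def)
  obtain a b where a: "a \<in> S - T" and b: "b \<in> T - S" using adjacent_obtain[OF adj] .
  have nz: "B a b \<noteq> 0" using adjacent_not_orthogonal[OF adj a b] .
  have qa: "Q a = 0" and qb: "Q b = 0" using a b generator_Q S T by auto
  define v where "v = a - b"
  have Qv: "Q v = - B a b"
  proof -
    have "Q a = Q v + Q b + B v b" using Q_add[of v b] by (simp add: v_def)
    then show ?thesis using qa qb B_self[of b] by (simp add: v_def B_simps eq_neg_iff_add_eq_0)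
  qed
  have "reflection v ` S \<subseteq> T"
  proof
    fix y assume "y \<in> reflection v ` S"
    then obtain x where x: "x \<in> S" "y = reflection v x" by blast
    obtain k where k: "x - k *s a \<in> S \<inter> T"
      using x adjacent_span[OF adj a] vec.span_breakdown_eq[of x a "S \<inter> T"]
        span_Int_generators[OF S T] by auto
    have "B (x - k *s a) v = 0"
      using k a b generator_B[OF S, of "x - k *s a" a] generator_B[OF T, of "x - k *s a" b]
      by (simp add: v_def B_diff_right)
    moreover have "B a v = - B a b"
      using B_self[of a] qa by (simp add: v_def B_diff_right)
    ultimately have "B x v = - k * B a b" by (simp add: B_simps eq_neg_iff_add_eq_0)
    then have "B x v / Q v = k" using nz by (simp add: Qv)
    then have "y = (x - k *s a) + k *s b"
      using x(2) by (simp add: reflection_def) (simp add: v_def vec.scale_right_diff_distrib)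
    then show "y \<in> T"
      using k b generator_subspace[OF T] by (metis DiffD1 IntD2 vec.subspace_add vec.subspace_scale)
  qed
  moreover have "Q v \<noteq> 0" using Qv nz by simp
  ultimately show thesis
    using that generator_eqI[OF reflection_generator[OF _ S] T] by blast
qed

text \<open>Reflections permute the generators and preserve disjointness, so the count is constant
  along paths of adjacent generators.\<close>

lemma card_disjoint_generators:
  assumes "S \<in> generators d Q" "T \<in> generators d Q"
  shows "card {R \<in> generators d Q. proj_disjoint S R} = card {R \<in> generators d Q. proj_disjoint T R}"
  using adjacent_connected[OF assms]
proof (induction rule: rtranclp_induct)
  case (step U V)
  obtain v where v: "Q v \<noteq> 0" "reflection v ` U = V"
    using adjacent_obtain_reflection[OF step.hyps(2)] .
  have disj: "proj_disjoint V (reflection v ` R) \<longleftrightarrow> proj_disjoint U R" for R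
  proof -
    have zero: "reflection v ` {0} = {0}" by (simp add: reflection_def)
    have "V \<inter> reflection v ` R = reflection v ` (U \<inter> R)"
      using v(2) inj_reflection[OF v(1)] by (simp add: image_Int)
    then show ?thesis
      unfolding proj_disjoint_def using inj_reflection[OF v(1)] zero by (metis inj_image_eq_iff)
  qed
  have "proj_disjoint U (reflection v ` R) \<longleftrightarrow> proj_disjoint V R" for R
    using disj[of "reflection v ` R"] reflection_image_image[OF v(1)] by simp
  with disj have "bij_betw ((`) (reflection v)) {R \<in> generators d Q. proj_disjoint U R}
      {R \<in> generators d Q. proj_disjoint V R}"
    by (intro bij_betw_byWitness[where f' = "(`) (reflection v)"])
      (auto simp: reflection_image_image[OF v(1)] reflection_generator[OF v(1)])
  then show ?case using step.IH by (simp add: bij_betw_same_card)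
qed simp

text \<open>If \<open>Q\<close> vanished, so would its polar form, and nonsingularity would make
  every vector zero; \<open>vec 1\<close> is not.\<close>

lemma exists_nonsingular_vector: "\<exists>v. Q v \<noteq> 0"
proof (rule ccontr)
  assume "\<not> ?thesis"
  then have "u = 0" for u :: "'f ^ 'n"
    using hyperbolic by (auto simp: hyperbolic_quadric_def nonsingular_def polar_form_def)
  then have "(vec 1 :: 'f ^ 'n) = 0" by blast
  then show False by (simp add: vec_eq_iff)
qed

section \<open>The two classes of generators\<close>

text \<open>The offsets by one in the projective dimensions cancel; a sum in place of a difference
  keeps the parity within the naturals.\<close>

lemma same_class_iff:
  "(S, T) \<in> same_class d Q \<longleftrightarrow>
    S \<in> generators d Q \<and> T \<in> generators d Q \<and> even (d + vec.dim (S \<inter> T))"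
proof -
  have "[proj_dim (S \<inter> T) = int d - 1] (mod 2) \<longleftrightarrow> even (d + vec.dim (S \<inter> T))"
    by (auto simp: proj_dim_def cong_iff_dvd_diff)
  then show ?thesis by (auto simp: same_class_def)
qed

lemma two_classes:
  assumes "\<Omega>\<^sub>1 \<in> generator_classes d Q" "\<Omega>\<^sub>2 \<in> generator_classes d Q" "\<Omega>\<^sub>1 \<noteq> \<Omega>\<^sub>2"
  obtains S where "S \<in> generators d Q"
    "\<Omega>\<^sub>1 = {T \<in> generators d Q. even (d + vec.dim (S \<inter> T))}"
    "\<Omega>\<^sub>2 = {T \<in> generators d Q. odd (d + vec.dim (S \<inter> T))}"
proof -
  obtain S where S: "S \<in> generators d Q" "\<Omega>\<^sub>1 = same_class d Q `` {S}"
    using assms(1) by (auto simp: generator_classes_def elim: quotientE)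
  obtain R where R: "R \<in> generators d Q" "\<Omega>\<^sub>2 = same_class d Q `` {R}"
    using assms(2) by (auto simp: generator_classes_def elim: quotientE)
  have 1: "\<Omega>\<^sub>1 = {T \<in> generators d Q. even (d + vec.dim (S \<inter> T))}"
    and 2: "\<Omega>\<^sub>2 = {T \<in> generators d Q. even (d + vec.dim (R \<inter> T))}"
    using S R by (auto simp: same_class_iff)
  have tri: "even (d + vec.dim (S \<inter> T)) \<longleftrightarrow>
      (even (d + vec.dim (S \<inter> R)) \<longleftrightarrow> even (d + vec.dim (R \<inter> T)))" if "T \<in> generators d Q" for T
    using even_dim_Int_triangle[OF S(1) R(1) that] .
  \<comment> \<open>Were it even, \<open>tri\<close> would make both classes coincide. Once it is
    odd, lying in the class of \<open>R\<close> means lying outside that of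
    \<open>S\<close>.\<close>
  have "odd (d + vec.dim (S \<inter> R))"
    using assms(3) tri unfolding 1 2 by blast
  then have "\<Omega>\<^sub>2 = {T \<in> generators d Q. odd (d + vec.dim (S \<inter> T))}"
    using tri unfolding 2 by blast
  with S(1) 1 show thesis by (rule that)
qed

lemma card_classes_eq:
  assumes "\<Omega>\<^sub>1 \<in> generator_classes d Q" "\<Omega>\<^sub>2 \<in> generator_classes d Q" "\<Omega>\<^sub>1 \<noteq> \<Omega>\<^sub>2"
  shows "card \<Omega>\<^sub>1 = card \<Omega>\<^sub>2"
proof -
  obtain S where S: "S \<in> generators d Q"
    "\<Omega>\<^sub>1 = {T \<in> generators d Q. even (d + vec.dim (S \<inter> T))}"
    "\<Omega>\<^sub>2 = {T \<in> generators d Q. odd (d + vec.dim (S \<inter> T))}"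
    using two_classes[OF assms] .
  obtain v where v: "Q v \<noteq> 0" using exists_nonsingular_vector by blast
  have "even (d + vec.dim (S \<inter> reflection v ` T)) \<longleftrightarrow> odd (d + vec.dim (S \<inter> T))"
    if "T \<in> generators d Q" for T
    using even_dim_Int_adjacent[OF adjacent_reflection[OF v that] S(1)] by auto
  then have "bij_betw ((`) (reflection v)) \<Omega>\<^sub>1 \<Omega>\<^sub>2"
    by (intro bij_betw_byWitness[where f' = "(`) (reflection v)"])
      (auto simp: S reflection_image_image[OF v] reflection_generator[OF v])
  then show ?thesis by (rule bij_betw_same_card)
qed

end

section \<open>Cameron-Liebler sets\<close>

text \<open>Counts related pairs in \<open>G \<times> L\<close>: each \<open>T\<close> contributes
  \<open>N\<close>, while each \<open>S\<close> contributes \<open>x * k\<close>, less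
  \<open>k\<close> if it lies in \<open>L\<close>.\<close>

lemma card_regular_double_count:
  fixes x k :: real
  assumes fin: "finite G" and L: "L \<subseteq> G" and sym: "\<And>S T. R S T \<longleftrightarrow> R T S"
    and N: "\<And>T. T \<in> L \<Longrightarrow> card {S \<in> G. R T S} = N"
    and x: "\<And>S. S \<in> G \<Longrightarrow> real (card {T \<in> L. R S T}) = (x - of_bool (S \<in> L)) * k"
  shows "real (card L) * (real N + k) = x * real (card G) * k"
proof -
  have finL: "finite L" using fin L finite_subset by blast
  have "(\<Sum>S\<in>G. card {T \<in> L. R S T}) = N * card L"
    using N sym by (intro sum_multicount fin finL) auto
  then have "real N * real (card L) = (\<Sum>S\<in>G. real (card {T \<in> L. R S T}))"
    by (metis of_nat_mult of_nat_sum)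
  also have "\<dots> = (\<Sum>S\<in>G. (x - of_bool (S \<in> L)) * k)"
    by (intro sum.cong) (simp_all add: x)
  also have "\<dots> = (x * real (card G) - real (card (G \<inter> L))) * k"
    using fin by (simp add: sum_distrib_right[symmetric] sum_subtractf)
  also have "G \<inter> L = L" using L by blast
  finally show ?thesis by (simp add: algebra_simps)
qed

theorem theorem3p19:
  fixes Q :: "'f::{field,finite} ^ 'n::finite \<Rightarrow> 'f"
    and d :: nat
    and L \<Omega>\<^sub>1 \<Omega>\<^sub>2 :: "('f ^ 'n) set set"
    and x :: real
  assumes "hyperbolic_quadric d Q"
    and "even d"
    and "L \<subseteq> generators d Q"
    and "\<Omega>\<^sub>1 \<in> generator_classes d Q"
    and "\<Omega>\<^sub>2 \<in> generator_classes d Q"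
    and "\<Omega>\<^sub>1 \<noteq> \<Omega>\<^sub>2"
  shows "cameron_liebler_set d Q L x \<longleftrightarrow>
    cameron_liebler_set_of_class d \<Omega>\<^sub>1 (L \<inter> \<Omega>\<^sub>1) x \<and>
    cameron_liebler_set_of_class d \<Omega>\<^sub>2 (L \<inter> \<Omega>\<^sub>2) x"
proof -
  interpret hyperbolic_space d Q by unfold_locales (rule assms)
  let ?G = "generators d Q"
  let ?k = "real CARD('f) ^ ((d - 1) choose 2)"
  let ?P = "\<Prod>i = 1..<d - 1. real CARD('f) ^ i + 1"
  obtain S\<^sub>0 where S0: "S\<^sub>0 \<in> ?G" and \<Omega>1: "\<Omega>\<^sub>1 = {T \<in> ?G. even (d + vec.dim (S\<^sub>0 \<inter> T))}"
    and \<Omega>2: "\<Omega>\<^sub>2 = {T \<in> ?G. odd (d + vec.dim (S\<^sub>0 \<inter> T))}"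
    using two_classes[OF assms(4-6)] .
  have un: "\<Omega>\<^sub>1 \<union> \<Omega>\<^sub>2 = ?G" and disj: "\<Omega>\<^sub>1 \<inter> \<Omega>\<^sub>2 = {}" by (auto simp: \<Omega>1 \<Omega>2)
  \<comment> \<open>Evenness of \<open>d\<close> enters here: disjoint generators meet in dimension
    0, and \<open>d + 0\<close> is even.\<close>
  have same: "S \<in> \<Omega>\<^sub>1 \<longleftrightarrow> T \<in> \<Omega>\<^sub>1" if "S \<in> ?G" "T \<in> ?G" "proj_disjoint S T" for S T
  proof -
    have "even (d + vec.dim (S \<inter> T))" using that(3) assms(2) by (simp add: proj_disjoint_def)
    then show ?thesis using even_dim_Int_triangle[OF S0 that(1,2)] that by (simp add: \<Omega>1)
  qed
  \<comment> \<open>Restricting to the class of \<open>S\<close> thus discards nothing disjoint from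
    \<open>S\<close>. The set \<open>M\<close> is general because both \<open>L\<close> and the set
    of all generators take its place.\<close>
  have loc: "{T \<in> M \<inter> \<Omega>. proj_disjoint S T} = {T \<in> M. proj_disjoint S T}"
    if "\<Omega> = \<Omega>\<^sub>1 \<or> \<Omega> = \<Omega>\<^sub>2" "S \<in> \<Omega>" "M \<subseteq> ?G" for S \<Omega> M
    using that same un disj by blast
  have local_iff: "(\<forall>S\<in>\<Omega>. real (card {T \<in> L \<inter> \<Omega>. proj_disjoint S T}) = (x - of_bool (S \<in> L \<inter> \<Omega>)) * ?k)
      \<longleftrightarrow> (\<forall>S\<in>\<Omega>. real (card {T \<in> L. proj_disjoint S T}) = (x - of_bool (S \<in> L)) * ?k)"
    if "\<Omega> = \<Omega>\<^sub>1 \<or> \<Omega> = \<Omega>\<^sub>2" for \<Omega>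
    using loc[OF that _ assms(3)] by (intro ball_cong) auto
  \<comment> \<open>The factor at \<open>i = 0\<close> is 2; it is present because \<open>d\<close>,
    even and positive, exceeds 1.\<close>
  have split: "(\<Prod>i = 0..<d - 1. real CARD('f) ^ i + 1) = 2 * ?P"
  proof -
    have "d - 1 > 0" using d_pos assms(2) by (cases "d = 1") auto
    then show ?thesis by (simp add: prod.atLeast_Suc_lessThan)
  qed
  have "card L = card (L \<inter> \<Omega>\<^sub>1) + card (L \<inter> \<Omega>\<^sub>2)"
    using assms(3) un disj by (subst card_Un_disjoint[symmetric]) (auto intro!: arg_cong[of _ _ card])
  then have cardL: "real (card L) = real (card (L \<inter> \<Omega>\<^sub>1)) + real (card (L \<inter> \<Omega>\<^sub>2))" by simp
  have eq: "card (L \<inter> \<Omega>\<^sub>1) = card (L \<inter> \<Omega>\<^sub>2)"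
    if cond: "\<forall>S\<in>?G. real (card {T \<in> L. proj_disjoint S T}) = (x - of_bool (S \<in> L)) * ?k"
  proof -
    define N where "N = card {R \<in> ?G. proj_disjoint S\<^sub>0 R}"
    have count: "real (card (L \<inter> \<Omega>)) * (real N + ?k) = x * real (card \<Omega>) * ?k"
      if \<Omega>: "\<Omega> = \<Omega>\<^sub>1 \<or> \<Omega> = \<Omega>\<^sub>2" for \<Omega>
    proof (rule card_regular_double_count[where R = proj_disjoint])
      have sub: "\<Omega> \<subseteq> ?G" using \<Omega> un by blast
      show "finite \<Omega>" "L \<inter> \<Omega> \<subseteq> \<Omega>" by simp_all
      show "proj_disjoint S T \<longleftrightarrow> proj_disjoint T S" for S T :: "('f ^ 'n) set"
        by (auto simp: proj_disjoint_def)
      show "card {S \<in> \<Omega>. proj_disjoint T S} = N" if "T \<in> L \<inter> \<Omega>" for T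
      proof -
        have T: "T \<in> \<Omega>" "T \<in> ?G" and "?G \<inter> \<Omega> = \<Omega>" using that sub by blast+
        then have "{S \<in> \<Omega>. proj_disjoint T S} = {S \<in> ?G. proj_disjoint T S}"
          using loc[OF \<Omega> T(1) order_refl] by simp
        then show ?thesis
          using card_disjoint_generators[OF S0 T(2)] by (simp add: N_def)
      qed
      show "real (card {T \<in> L \<inter> \<Omega>. proj_disjoint S T}) = (x - of_bool (S \<in> L \<inter> \<Omega>)) * ?k"
        if "S \<in> \<Omega>" for S
        using that sub cond local_iff[OF \<Omega>] by blast
    qed
    \<comment> \<open>The right-hand sides of \<open>count\<close> agree for the two classes, and
      this positive factor cancels.\<close>
    have "real N + ?k > 0" by (simp add: add_nonneg_pos)
    then show ?thesis
      using count[of \<Omega>\<^sub>1] count[of \<Omega>\<^sub>2] card_classes_eq[OF assms(4-6)]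
      by (metis less_irrefl mult_right_cancel of_nat_eq_iff)
  qed
  have cond_iff: "(\<forall>S\<in>?G. real (card {T \<in> L. proj_disjoint S T}) = (x - of_bool (S \<in> L)) * ?k)
      \<longleftrightarrow> (\<forall>S\<in>\<Omega>\<^sub>1. real (card {T \<in> L. proj_disjoint S T}) = (x - of_bool (S \<in> L)) * ?k)
        \<and> (\<forall>S\<in>\<Omega>\<^sub>2. real (card {T \<in> L. proj_disjoint S T}) = (x - of_bool (S \<in> L)) * ?k)"
    unfolding un[symmetric] by blast
  have all: "cameron_liebler_set d Q L x \<longleftrightarrow> x = real (card L) / (2 * ?P) \<and>
      (\<forall>S\<in>?G. real (card {T \<in> L. proj_disjoint S T}) = (x - of_bool (S \<in> L)) * ?k)"
    using assms(3) unfolding cameron_liebler_set_def split by blast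
  have one: "cameron_liebler_set_of_class d \<Omega> (L \<inter> \<Omega>) x \<longleftrightarrow> x = real (card (L \<inter> \<Omega>)) / ?P \<and>
      (\<forall>S\<in>\<Omega>. real (card {T \<in> L. proj_disjoint S T}) = (x - of_bool (S \<in> L)) * ?k)"
    if "\<Omega> = \<Omega>\<^sub>1 \<or> \<Omega> = \<Omega>\<^sub>2" for \<Omega>
    unfolding cameron_liebler_set_of_class_def local_iff[OF that] by blast
  show ?thesis
  proof
    assume *: "cameron_liebler_set d Q L x"
    then have "card (L \<inter> \<Omega>\<^sub>1) = card (L \<inter> \<Omega>\<^sub>2)" using all eq by blast
    \<comment> \<open>\<open>card L\<close> is now twice the size of either part, and this 2 cancels
      against the one from \<open>split\<close>.\<close>
    then have "x = real (card (L \<inter> \<Omega>\<^sub>1)) / ?P" "x = real (card (L \<inter> \<Omega>\<^sub>2)) / ?P"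
      using * all cardL by simp_all
    then show "cameron_liebler_set_of_class d \<Omega>\<^sub>1 (L \<inter> \<Omega>\<^sub>1) x \<and>
        cameron_liebler_set_of_class d \<Omega>\<^sub>2 (L \<inter> \<Omega>\<^sub>2) x"
      using * all one cond_iff by blast
  next
    assume *: "cameron_liebler_set_of_class d \<Omega>\<^sub>1 (L \<inter> \<Omega>\<^sub>1) x \<and>
        cameron_liebler_set_of_class d \<Omega>\<^sub>2 (L \<inter> \<Omega>\<^sub>2) x"
    then have "x = real (card (L \<inter> \<Omega>\<^sub>1)) / ?P" "x = real (card (L \<inter> \<Omega>\<^sub>2)) / ?P"
      using one by blast+
    \<comment> \<open>Conversely, the parameter of \<open>L\<close> is the mean of those of the two
      parts, both equal to \<open>x\<close>.\<close>
    moreover have "x = (a + b) / (2 * P)" if "x = a / P" "x = b / P" for a b P :: real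
    proof -
      have "(a + b) / (2 * P) = (a / P + b / P) / 2" by (simp add: add_divide_distrib)
      then show ?thesis unfolding that[symmetric] by simp
    qed
    ultimately have "x = real (card L) / (2 * ?P)" unfolding cardL by blast
    then show "cameron_liebler_set d Q L x" using * all one cond_iff by blast
  qed
qed

end
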